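(* The price of anarchy, with respect to liquid welfare, of coarse correlated equilibria in discriminatory price multi-unit auctions with budgets is at least $$\frac{2+\mathcal W_0(-e^{-2})}{1+\mathcal W_0(-e^{-2})}\approx2.188.$$ That is, the supremum of $\mathrm{OPT}(I)/\mathrm{LW}(I,A)$ over all such instances $I$ and all coarse correlated equilibria $A$ of $I$ is at least this number.
   Context: $\mathcal W_0$ is the principal real branch of the Lambert function: $\mathcal W_0(-e^{-2})$ is the unique $w\in[-1,0)$ with $we^w=-e^{-2}$. Discriminatory price auction: bidders $N=[n]$, $n\ge2$, and $k\ge1$ identical units. Bidder $i$'s action is $a_i=(b_i,q_i)\in\mathcal A_i=\mathbb R_{\ge0}\times\{0,1,\dots,k\}$: a per-unit bid and a demanded quantity; $\mathcal A=\prod_i\mathcal A_i$. The marginal bids form the multiset containing $q_i$ copies of $b_i$ for each $i$. The auctioneer allocates the $k$ units to the $k$ highest marginal bids, with ties broken consistently (if fewer than $k$ marginal bids are submitted, the missing entries are treated as bids of $0$). $X_i(a)\in\{0,\dots,k\}$ is the number of units won by $i$, who pays $P_i(a)=b_iX_i(a)$. Bidder $i$ has a concave valuation $v_i:\{0,1,\dots,k\}\to\mathbb R_{\ge0}$ with $v_i(0)=0$ and a budget $B_i\in(0,\infty]$. Utility: $u_i(a)=v_i(X_i(a))-P_i(a)$. Feasible allocations: $\mathcal X=\{x\in\{0,\dots,k\}^n:\sum_ix_i\le k\}$. An instance $I$ consists of the bidders, the number of units, the valuations and the budgets. $\Delta(S)$ denotes probability distributions on $S$. For $A\in\Delta(\mathcal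 A)$ let $A_{-i}$ be the marginal on the others' actions, and let $\mathcal C_i(A_{-i})$ be the set of $A_i'\in\Delta(\mathcal A_i)$ with $\mathbb E_{a_i'\sim A_i',a_{-i}\sim A_{-i}}[P_i(a_i',a_{-i})]\le B_i$ (independent draws). $A\in\Delta(\mathcal A)$ is a coarse correlated equilibrium if for all $i$: $\mathbb E_{a\sim A}[P_i(a)]\le B_i$, and $\mathbb E_{a\sim A}[u_i(a)]\ge\mathbb E_{a_i'\sim A_i',a_{-i}\sim A_{-i}}[u_i(a_i',a_{-i})]$ for all $A_i'\in\mathcal C_i(A_{-i})$. $\mathrm{LW}(I,A)=\sum_i\min\{\mathbb E_{a\sim A}[v_i(X_i(a))],B_i\}$ and $\mathrm{OPT}(I)=\max_{\chi\in\Delta(\mathcal X)}\sum_i\min\{\mathbb E_{x\sim\chi}[v_i(x_i)],B_i\}$. *)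

theory Defs
  imports "HOL-Probability.Probability"
begin

definition lambert_W0 :: "real \<Rightarrow> real" where
  "lambert_W0 x = (THE w. -1 \<le> w \<and> w * exp w = x)"

text \<open>Expectation with values in the extended reals: the difference of the integrals of the
  positive and the negative part. Unlike the Bochner integral it does not return 0 for a
  function that is not integrable, so a strategy with infinite expected payment is neither
  affordable for a finite budget nor of utility 0.  All functions it is applied to
  below are bounded above or bounded below, so the difference is never infinity minus
  infinity.\<close>

definition expect :: "'a measure \<Rightarrow> ('a \<Rightarrow> real) \<Rightarrow> ereal" where
  "expect M f = enn2ereal (\<integral>\<^sup>+x. ennreal (f x) \<partial>M) - enn2ereal (\<integral>\<^sup>+x. ennreal (- f x) \<partial>M)"

abbreviation distributions :: "'a measure \<Rightarrow> 'a measure set" where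
  "distributions M \<equiv> space (prob_algebra M)"

text \<open>The bidders are \<open>0, \<dots>, num_bidders I - 1\<close>; values of \<open>val\<close> and \<open>budget\<close> outside the
  relevant ranges play no role.\<close>

record auction =
  num_bidders :: nat
  num_units :: nat
  val :: "nat \<Rightarrow> nat \<Rightarrow> real"
  budget :: "nat \<Rightarrow> ereal"

abbreviation bidders :: "auction \<Rightarrow> nat set" where
  "bidders I \<equiv> {..<num_bidders I}"

definition concave_valuation :: "nat \<Rightarrow> (nat \<Rightarrow> real) \<Rightarrow> bool" where
  "concave_valuation k v \<longleftrightarrow>
     v 0 = 0 \<and> (\<forall>x\<le>k. 0 \<le> v x) \<and>
     (\<forall>x. 1 \<le> x \<and> x < k \<longrightarrow> v (x + 1) - v x \<le> v x - v (x - 1))"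

definition valid_instance :: "auction \<Rightarrow> bool" where
  "valid_instance I \<longleftrightarrow>
     2 \<le> num_bidders I \<and> 1 \<le> num_units I \<and>
     (\<forall>i\<in>bidders I. concave_valuation (num_units I) (val I i) \<and> 0 < budget I i)"

text \<open>An action is a pair of a per-unit bid and a demanded quantity.\<close>

type_synonym action = "real \<times> nat"
type_synonym profile = "nat \<Rightarrow> action"

definition action_space :: "auction \<Rightarrow> action measure" where
  "action_space I = restrict_space borel {0..} \<Otimes>\<^sub>M count_space {0..num_units I}"

definition profile_space :: "auction \<Rightarrow> nat set \<Rightarrow> profile measure" where
  "profile_space I J = (\<Pi>\<^sub>M j\<in>J. action_space I)"

text \<open>The \<open>l\<close>-th copy of the bid of bidder \<open>i\<close> is labelled \<open>(i, l)\<close>.  Consistent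
  tie-breaking: for \<open>n\<close> bidders and \<open>k\<close> units there is a fixed linear order \<open>T n k\<close> on the
  labels, and among equal marginal bids the one that comes earlier in this order is preferred.
  (A priority order on the bidders is the special case of a lexicographic order.)\<close>

type_synonym tie_rule = "nat \<Rightarrow> nat \<Rightarrow> (nat \<times> nat) rel"

definition consistent_ties :: "tie_rule \<Rightarrow> bool" where
  "consistent_ties T \<longleftrightarrow> (\<forall>n k. strict_linear_order_on ({..<n} \<times> {1..k}) (T n k))"

definition marginal_bids :: "auction \<Rightarrow> profile \<Rightarrow> (nat \<times> nat) set" where
  "marginal_bids I a = (SIGMA i:bidders I. {1..snd (a i)})"

definition outranks :: "tie_rule \<Rightarrow> auction \<Rightarrow> profile \<Rightarrow> nat \<times> nat \<Rightarrow> nat \<times> nat \<Rightarrow> bool" where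
  "outranks T I a s t \<longleftrightarrow>
     fst (a (fst t)) < fst (a (fst s)) \<or>
     fst (a (fst t)) = fst (a (fst s)) \<and> (s, t) \<in> T (num_bidders I) (num_units I)"

definition winning_bids :: "tie_rule \<Rightarrow> auction \<Rightarrow> profile \<Rightarrow> (nat \<times> nat) set" where
  "winning_bids T I a =
     {t \<in> marginal_bids I a. card {s \<in> marginal_bids I a. outranks T I a s t} < num_units I}"

definition units_won :: "tie_rule \<Rightarrow> auction \<Rightarrow> nat \<Rightarrow> profile \<Rightarrow> nat" where
  "units_won T I i a = card {l. (i, l) \<in> winning_bids T I a}"

definition payment :: "tie_rule \<Rightarrow> auction \<Rightarrow> nat \<Rightarrow> profile \<Rightarrow> real" where
  "payment T I i a = fst (a i) * real (units_won T I i a)"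

definition utility :: "tie_rule \<Rightarrow> auction \<Rightarrow> nat \<Rightarrow> profile \<Rightarrow> real" where
  "utility T I i a = val I i (units_won T I i a) - payment T I i a"

definition others_marginal :: "auction \<Rightarrow> nat \<Rightarrow> profile measure \<Rightarrow> profile measure" where
  "others_marginal I i A =
     distr A (profile_space I (bidders I - {i})) (\<lambda>a. restrict a (bidders I - {i}))"

text \<open>Expectation of a function of the profile when bidder \<open>i\<close> draws an action from \<open>D\<close>
  independently of the others, who draw from \<open>M\<close>.\<close>

definition deviation_expect ::
    "nat \<Rightarrow> action measure \<Rightarrow> profile measure \<Rightarrow> (profile \<Rightarrow> real) \<Rightarrow> ereal" where
  "deviation_expect i D M f = expect (D \<Otimes>\<^sub>M M) (\<lambda>(x, y). f (y(i := x)))"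

definition affordable_deviations ::
    "tie_rule \<Rightarrow> auction \<Rightarrow> nat \<Rightarrow> profile measure \<Rightarrow> action measure set" where
  "affordable_deviations T I i M =
     {D \<in> distributions (action_space I). deviation_expect i D M (payment T I i) \<le> budget I i}"

definition coarse_correlated_equilibrium :: "tie_rule \<Rightarrow> auction \<Rightarrow> profile measure \<Rightarrow> bool" where
  "coarse_correlated_equilibrium T I A \<longleftrightarrow>
     A \<in> distributions (profile_space I (bidders I)) \<and>
     (\<forall>i\<in>bidders I.
        expect A (payment T I i) \<le> budget I i \<and>
        (\<forall>D\<in>affordable_deviations T I i (others_marginal I i A).
           deviation_expect i D (others_marginal I i A) (utility T I i)
             \<le> expect A (utility T I i)))"

definition liquid_welfare :: "tie_rule \<Rightarrow> auction \<Rightarrow> profile measure \<Rightarrow> ereal" where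
  "liquid_welfare T I A =
     (\<Sum>i\<in>bidders I. min (expect A (\<lambda>a. val I i (units_won T I i a))) (budget I i))"

definition feasible_allocations :: "auction \<Rightarrow> (nat \<Rightarrow> nat) set" where
  "feasible_allocations I =
     {x \<in> bidders I \<rightarrow>\<^sub>E {0..num_units I}. (\<Sum>i\<in>bidders I. x i) \<le> num_units I}"

text \<open>The supremum is attained, since the distributions on the finite set of feasible
  allocations form a compact set on which the objective is continuous.\<close>

definition optimal_liquid_welfare :: "auction \<Rightarrow> ereal" where
  "optimal_liquid_welfare I =
     (SUP D\<in>distributions (count_space (feasible_allocations I)).
        (\<Sum>i\<in>bidders I. min (expect D (\<lambda>x. val I i (x i))) (budget I i)))"

text \<open>Both welfares are finite and nonnegative for valid instances.  By the conventions of
  \<^typ>\<open>ereal\<close>, a positive number divided by 0 is \<open>\<infinity>\<close>, and 0 divided by 0 is 0.\<close>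

definition price_of_anarchy :: "tie_rule \<Rightarrow> ereal" where
  "price_of_anarchy T =
     Sup {optimal_liquid_welfare I / liquid_welfare T I A | I A.
            valid_instance I \<and> coarse_correlated_equilibrium T I A}"

end

theory Submission
  imports Defs
begin

text \<open>One unit and two bidders suffice. The low bidder \<open>l\<close> has value 1 and no budget; the high
  bidder \<open>h\<close>, the one favoured by the tie-breaking order, has a huge value \<open>V\<close> but a small budget
  \<open>B\<close>. Both submit the same random bid with distribution function \<open>b \<mapsto> u / (1 - b)\<close> on
  \<open>[0, 1 - u]\<close>. At the atom \<open>b = 0\<close>, of mass \<open>u\<close>, \<open>h\<close> demands nothing and \<open>l\<close> wins for free;
  otherwise \<open>h\<close> wins, and \<open>B = 1 - u + u ln u\<close> is exactly its expected payment. No bid gives \<open>l\<close> more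
  than utility \<open>u\<close>, and no affordable strategy of \<open>h\<close> wins with probability more than \<open>B + u\<close>,
  which is less than \<open>1 - u\<close>. The liquid welfare is \<open>B + u\<close>. Giving \<open>h\<close> the unit with probability
  only \<open>B / V\<close> already exhausts its budget, so the optimum tends to \<open>B + 1\<close> as \<open>V \<rightarrow> \<infinity>\<close>. The ratio
  \<open>(B + 1) / (B + u)\<close> is largest when \<open>ln u = u - 2\<close>, that is, at \<open>u = - W\<^sub>0 (- exp (- 2))\<close>.\<close>

section \<open>Extended-real expectations\<close>

lemma expect_nonneg:
  assumes "\<And>x. x \<in> space M \<Longrightarrow> 0 \<le> f x" and "(\<integral>\<^sup>+x. ennreal (f x) \<partial>M) = ennreal c" and "0 \<le> c"
  shows "expect M f = ereal c"
proof -
  have "(\<integral>\<^sup>+x. ennreal (- f x) \<partial>M) = (\<integral>\<^sup>+x. 0 \<partial>M)"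
    by (intro nn_integral_cong) (use assms(1) in \<open>auto simp: ennreal_eq_0_iff\<close>)
  then show ?thesis
    using assms(2,3) by (simp add: expect_def zero_ennreal.rep_eq)
qed

text \<open>The negative part can only lower the expectation, even when its integral is infinite.
  This suits deviation utilities, which are unbounded below because bids are unbounded.\<close>

lemma expect_le:
  assumes "(\<integral>\<^sup>+x. ennreal (f x) \<partial>M) \<le> ennreal c" and "0 \<le> c"
  shows "expect M f \<le> ereal c"
proof -
  have "enn2ereal (\<integral>\<^sup>+x. ennreal (f x) \<partial>M) \<le> ereal c"
    using assms by (metis enn2ereal_ennreal less_eq_ennreal.rep_eq)
  then have "enn2ereal (\<integral>\<^sup>+x. ennreal (f x) \<partial>M) - enn2ereal (\<integral>\<^sup>+x. ennreal (- f x) \<partial>M) \<le> ereal c - 0"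
    by (intro ereal_minus_mono) auto
  then show ?thesis by (simp add: expect_def)
qed

text \<open>Turns a budget constraint on a payment into a bound on a nonnegative integral.\<close>

lemma nn_integral_le_of_expect_le:
  assumes "\<And>x. x \<in> space M \<Longrightarrow> 0 \<le> f x" and "expect M f \<le> ereal c" and "0 \<le> c"
  shows "(\<integral>\<^sup>+x. ennreal (f x) \<partial>M) \<le> ennreal c"
proof -
  have "(\<integral>\<^sup>+x. ennreal (- f x) \<partial>M) = (\<integral>\<^sup>+x. 0 \<partial>M)"
    by (intro nn_integral_cong) (use assms(1) in \<open>auto simp: ennreal_eq_0_iff\<close>)
  then show ?thesis
    using assms(2,3) by (simp add: expect_def less_eq_ennreal.rep_eq zero_ennreal.rep_eq)
qed

lemma expect_distr:
  assumes "g \<in> M \<rightarrow>\<^sub>M N" and "f \<in> borel_measurable N"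
  shows "expect (distr M N g) f = expect M (\<lambda>x. f (g x))"
  using assms by (simp add: expect_def nn_integral_distr)

section \<open>Deviations from profiles driven by a random seed\<close>

lemma measurable_deviation:
  assumes "i \<in> bidders I"
  shows "(\<lambda>(x, y). y(i := x)) \<in>
    action_space I \<Otimes>\<^sub>M profile_space I (bidders I - {i}) \<rightarrow>\<^sub>M profile_space I (bidders I)"
proof -
  have "(\<lambda>p. (snd p, fst p)) \<in> action_space I \<Otimes>\<^sub>M profile_space I (bidders I - {i}) \<rightarrow>\<^sub>M
      profile_space I (bidders I - {i}) \<Otimes>\<^sub>M action_space I"
    by measurable
  note upd = measurable_compose[OF this[unfolded profile_space_def] measurable_add_dim[where i = i]]
  have "insert i (bidders I - {i}) = bidders I" using assms by blast
  then show ?thesis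
    using upd by (simp only: profile_space_def case_prod_unfold fst_conv snd_conv)
qed

text \<open>If the seed \<open>s\<close> produces the profile \<open>g s\<close>, a deviation is an
  independent pair of an action and a seed. The component of \<open>g s\<close> at \<open>i\<close>
  is overwritten, so dropping it first, as \<open>others_marginal\<close> does, changes
  nothing.\<close>

lemma deviation_expect_distr:
  assumes i: "i \<in> bidders I" and D: "D \<in> distributions (action_space I)"
    and g: "g \<in> M \<rightarrow>\<^sub>M profile_space I (bidders I)" and M: "prob_space M"
    and f: "f \<in> borel_measurable (profile_space I (bidders I))"
  shows "deviation_expect i D (others_marginal I i (distr M (profile_space I (bidders I)) g)) f =
    expect (D \<Otimes>\<^sub>M M) (\<lambda>(x, s). f ((g s)(i := x)))"
    and "(\<lambda>(x, s). f ((g s)(i := x))) \<in> borel_measurable (D \<Otimes>\<^sub>M M)"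
proof -
  let ?P = "profile_space I (bidders I)" and ?Q = "profile_space I (bidders I - {i})"
  let ?r = "\<lambda>s. restrict (g s) (bidders I - {i})"
  have sD[measurable_cong]: "sets D = sets (action_space I)" and pD: "prob_space D"
    using D by (auto simp: space_prob_algebra)
  have r: "(\<lambda>a. restrict a (bidders I - {i})) \<in> ?P \<rightarrow>\<^sub>M ?Q"
    unfolding profile_space_def by (rule measurable_restrict_subset) auto
  have rg[measurable]: "?r \<in> M \<rightarrow>\<^sub>M ?Q"
    using measurable_compose[OF g r] .
  have om: "others_marginal I i (distr M ?P g) = distr M ?Q ?r"
    unfolding others_marginal_def using distr_distr[OF r g] by (simp add: comp_def)
  have sf: "sigma_finite_measure (distr M ?Q ?r)"
    using prob_space.prob_space_distr[OF M rg] by (simp add: prob_space_imp_sigma_finite)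
  have pair: "D \<Otimes>\<^sub>M distr M ?Q ?r = distr (D \<Otimes>\<^sub>M M) (D \<Otimes>\<^sub>M ?Q) (\<lambda>(x, s). (x, ?r s))"
    using pair_measure_distr[OF measurable_ident[of D] rg sf] by (simp add: distr_id id_def)
  have upd: "(\<lambda>(x, y). y(i := x)) \<in> D \<Otimes>\<^sub>M ?Q \<rightarrow>\<^sub>M ?P"
    using measurable_deviation[OF i] measurable_cong_sets[OF sets_pair_measure_cong[OF sD refl] refl] by blast
  have fu: "(\<lambda>(x, y). f (y(i := x))) \<in> borel_measurable (D \<Otimes>\<^sub>M ?Q)"
    using measurable_compose[OF upd f] by (simp add: case_prod_unfold)
  have m: "(\<lambda>(x, s). (x, ?r s)) \<in> D \<Otimes>\<^sub>M M \<rightarrow>\<^sub>M D \<Otimes>\<^sub>M ?Q" by measurable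
  have gsp: "g s \<in> space ?P" if "s \<in> space M" for s
    using measurable_space[OF g that] .
  \<comment> \<open>Outside the set of bidders both profiles are \<open>undefined\<close>, since
    \<open>g s\<close> is extensional; at \<open>i\<close> both equal \<open>x\<close>.\<close>
  have eq: "f ((?r s)(i := x)) = f ((g s)(i := x))" if "s \<in> space M" for s x
  proof -
    have "((?r s)(i := x)) j = ((g s)(i := x)) j" for j
      using gsp[OF that] by (auto simp: profile_space_def space_PiM PiE_def extensional_def)
    then show ?thesis by presburger
  qed
  show "(\<lambda>(x, s). f ((g s)(i := x))) \<in> borel_measurable (D \<Otimes>\<^sub>M M)"
    by (rule measurable_cong[THEN iffD1, OF _ measurable_compose[OF m fu]])
      (auto simp: space_pair_measure eq simp del: restrict_upd fun_upd_restrict_conv)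
  show "deviation_expect i D (others_marginal I i (distr M ?P g)) f =
    expect (D \<Otimes>\<^sub>M M) (\<lambda>(x, s). f ((g s)(i := x)))"
    unfolding deviation_expect_def om pair expect_distr[OF m fu]
    unfolding expect_def
    by (intro arg_cong2[where f="(-)"] arg_cong[where f=enn2ereal] nn_integral_cong)
      (auto simp: space_pair_measure eq simp del: restrict_upd fun_upd_restrict_conv)
qed

section \<open>The auction, the uniform seed and the common bid\<close>

definition single_item_auction :: "nat \<Rightarrow> real \<Rightarrow> real \<Rightarrow> auction" where
  "single_item_auction h V B = \<lparr>num_bidders = 2, num_units = 1,
     val = (\<lambda>i x. if x = 0 then 0 else if i = h then V else 1),
     budget = (\<lambda>i. if i = h then ereal B else \<infinity>)\<rparr>"

definition unit_uniform :: "real measure" where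
  "unit_uniform = uniform_measure lborel {0..1}"

lemma sets_unit_uniform[measurable_cong, simp]: "sets unit_uniform = sets borel"
  by (simp add: unit_uniform_def)

lemma space_unit_uniform[simp]: "space unit_uniform = UNIV"
  by (simp add: unit_uniform_def)

lemma prob_space_unit_uniform: "prob_space unit_uniform"
  unfolding unit_uniform_def by (rule prob_space_uniform_measure) auto

lemma emeasure_unit_uniform_atMost:
  assumes "0 \<le> c" "c \<le> 1"
  shows "emeasure unit_uniform {..c} = ennreal c"
proof -
  have "{0..1} \<inter> {..c} = {0..c}" using assms by auto
  then show ?thesis using assms by (simp add: unit_uniform_def divide_ennreal_def)
qed

lemma emeasure_unit_uniform_atMost_le:
  assumes "0 \<le> c"
  shows "emeasure unit_uniform {..c} \<le> ennreal c"
proof -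
  have "{0..1} \<inter> {..c} \<subseteq> {0..c}" using assms by auto
  then have "emeasure lborel ({0..1} \<inter> {..c}) \<le> emeasure lborel {0..c}"
    by (intro emeasure_mono) auto
  then show ?thesis using assms by (simp add: unit_uniform_def divide_ennreal_def)
qed

lemma nn_integral_unit_uniform_upper:
  fixes u :: real
  assumes "0 < u" "u < 1" and [measurable]: "g \<in> borel_measurable borel"
    and "\<And>s. u \<le> s \<Longrightarrow> s \<le> 1 \<Longrightarrow> 0 \<le> g s"
    and "\<And>s. u \<le> s \<Longrightarrow> s \<le> 1 \<Longrightarrow> (G has_real_derivative g s) (at s)"
  shows "(\<integral>\<^sup>+s. ennreal (if s \<le> u then 0 else g s) \<partial>unit_uniform) = ennreal (G 1 - G u)"
proof -
  have "(\<integral>\<^sup>+s. ennreal (if s \<le> u then 0 else g s) \<partial>unit_uniform) =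
      (\<integral>\<^sup>+s. ennreal (if s \<le> u then 0 else g s) * indicator {0..1} s \<partial>lborel)"
    unfolding unit_uniform_def by (subst nn_integral_uniform_measure) (auto simp: divide_ennreal_def)
  \<comment> \<open>The two integrands can differ only at \<open>s = u\<close>, a null set.\<close>
  also have "\<dots> = (\<integral>\<^sup>+s. ennreal (g s) * indicator {u..1} s \<partial>lborel)"
    by (intro nn_integral_cong_AE, use AE_lborel_singleton[of u] in eventually_elim)
      (use assms in \<open>auto simp: indicator_def\<close>)
  also have "\<dots> = ennreal (G 1 - G u)"
    by (rule nn_integral_FTC_Icc) (use assms in \<open>auto intro: has_field_derivative_at_within\<close>)
  finally show ?thesis .
qed

text \<open>The common bid as a function of the random seed \<open>s\<close>, distributed so that
  \<open>P (bid \<le> b) = u / (1 - b)\<close>: a bidder of value 1 facing it is indifferent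
  between all bids.\<close>

definition seed_bid :: "real \<Rightarrow> real \<Rightarrow> real" where
  "seed_bid u s = (if s \<le> u then 0 else 1 - u / s)"

lemma measurable_seed_bid[measurable]: "seed_bid u \<in> borel_measurable borel"
  unfolding seed_bid_def by measurable

lemma seed_bid_nonneg: "0 < u \<Longrightarrow> 0 \<le> seed_bid u s"
  by (auto simp: seed_bid_def)

text \<open>For \<open>b < 1\<close>, the common bid is at most \<open>b\<close> only if the seed is
  at most \<open>u / (1 - b)\<close>. For \<open>b \<ge> 1\<close> the first factor is truncated to
  0.\<close>

lemma seed_bid_win_bound:
  assumes "0 < u" "0 \<le> b"
  shows "ennreal (1 - b) * emeasure unit_uniform {s. seed_bid u s \<le> b} \<le> ennreal u"
proof (cases "b < 1")
  case True
  have "{s. seed_bid u s \<le> b} \<subseteq> {..u / (1 - b)}"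
  proof clarsimp
    fix s assume s: "seed_bid u s \<le> b"
    show "s \<le> u / (1 - b)"
    proof (cases "s \<le> u")
      case True
      moreover have "u * (1 - b) \<le> u" using assms by (simp add: mult_left_le)
      ultimately show ?thesis using \<open>b < 1\<close> by (smt (verit) pos_le_divide_eq)
    next
      case False
      then have "(1 - b) * s \<le> u" using s assms by (simp add: seed_bid_def field_simps)
      then show ?thesis using True by (simp add: field_simps)
    qed
  qed
  then have "emeasure unit_uniform {s. seed_bid u s \<le> b} \<le> ennreal (u / (1 - b))"
    using assms True
    by (intro order.trans[OF emeasure_mono emeasure_unit_uniform_atMost_le]) auto
  then have "ennreal (1 - b) * emeasure unit_uniform {s. seed_bid u s \<le> b} \<le>
      ennreal (1 - b) * ennreal (u / (1 - b))"
    by (rule mult_left_mono) simp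
  also have "\<dots> = ennreal u" using True assms by (simp flip: ennreal_mult)
  finally show ?thesis .
qed (simp add: ennreal_neg)

text \<open>By independence, Fubini averages \<open>seed_bid_win_bound\<close> over the bid of the
  deviator. For \<open>l\<close> this caps the gain from deviating; for \<open>h\<close> it ties the
  probability of winning to the cost.\<close>

lemma deviation_win_bound:
  assumes D: "D \<in> distributions (action_space I)" and u: "0 < u"
  shows "(\<integral>\<^sup>+(x, s). ennreal (1 - fst x) * indicator {s. seed_bid u s \<le> fst x} s
    \<partial>(D \<Otimes>\<^sub>M unit_uniform)) \<le> ennreal u"
    and "(\<lambda>(x, s). ennreal (1 - fst x) * indicator {s. seed_bid u s \<le> fst x} s) \<in>
      borel_measurable (D \<Otimes>\<^sub>M unit_uniform)"
proof -
  interpret U: prob_space unit_uniform by (rule prob_space_unit_uniform)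
  interpret D: prob_space D using D by (simp add: space_prob_algebra)
  have sD[measurable_cong]: "sets D = sets (restrict_space borel {0..} \<Otimes>\<^sub>M count_space {0..num_units I})"
    using D by (simp add: space_prob_algebra action_space_def)
  have [measurable]: "fst \<in> borel_measurable D"
    unfolding measurable_cong_sets[OF sD refl] by (rule measurable_compose[OF measurable_fst]) (simp add: measurable_restrict_space1)
  have nn: "0 \<le> fst x" if "x \<in> space D" for x
    using that unfolding sets_eq_imp_space_eq[OF sD] by (auto simp: space_pair_measure space_restrict_space)
  have "(\<lambda>p. ennreal (1 - fst (fst p)) * indicator {p. seed_bid u (snd p) \<le> fst (fst p)} p) \<in>
      borel_measurable (D \<Otimes>\<^sub>M unit_uniform)"
    by measurable
  then show m: "(\<lambda>(x, s). ennreal (1 - fst x) * indicator {s. seed_bid u s \<le> fst x} s) \<in>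
      borel_measurable (D \<Otimes>\<^sub>M unit_uniform)"
    by (simp add: case_prod_unfold indicator_def)
  have "(\<integral>\<^sup>+(x, s). ennreal (1 - fst x) * indicator {s. seed_bid u s \<le> fst x} s \<partial>(D \<Otimes>\<^sub>M unit_uniform)) =
     (\<integral>\<^sup>+x. \<integral>\<^sup>+s. ennreal (1 - fst x) * indicator {s. seed_bid u s \<le> fst x} s \<partial>unit_uniform \<partial>D)"
    by (subst U.nn_integral_fst[OF m, symmetric]) simp
  also have "\<dots> = (\<integral>\<^sup>+x. ennreal (1 - fst x) * emeasure unit_uniform {s. seed_bid u s \<le> fst x} \<partial>D)"
    by (intro nn_integral_cong nn_integral_cmult_indicator) measurable
  also have "\<dots> \<le> (\<integral>\<^sup>+x. ennreal u \<partial>D)"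
    by (intro nn_integral_mono seed_bid_win_bound[OF u] nn)
  also have "\<dots> = ennreal u" by (simp add: D.emeasure_space_1)
  finally show "(\<integral>\<^sup>+(x, s). ennreal (1 - fst x) * indicator {s. seed_bid u s \<le> fst x} s
    \<partial>(D \<Otimes>\<^sub>M unit_uniform)) \<le> ennreal u" .
qed

lemma measurable_beats:
  fixes b b' :: "'a \<Rightarrow> real" and q q' :: "'a \<Rightarrow> nat"
  assumes [measurable]: "b \<in> borel_measurable M" "q \<in> M \<rightarrow>\<^sub>M count_space UNIV"
    "b' \<in> borel_measurable M" "q' \<in> M \<rightarrow>\<^sub>M count_space UNIV"
  shows "(\<lambda>a. of_bool (q a = 1 \<and> (q' a = 1 \<longrightarrow> b' a \<le> b a)) :: nat) \<in> M \<rightarrow>\<^sub>M count_space UNIV"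
    and "(\<lambda>a. of_bool (q a = 1 \<and> (q' a = 1 \<longrightarrow> b' a < b a)) :: nat) \<in> M \<rightarrow>\<^sub>M count_space UNIV"
proof -
  have [measurable]: "Measurable.pred M (\<lambda>a. b' a \<le> b a)" "Measurable.pred M (\<lambda>a. b' a < b a)"
    using assms(1,3) by (simp_all add: borel_measurable_le borel_measurable_less pred_def)
  show "(\<lambda>a. of_bool (q a = 1 \<and> (q' a = 1 \<longrightarrow> b' a \<le> b a)) :: nat) \<in> M \<rightarrow>\<^sub>M count_space UNIV"
    unfolding of_bool_def using assms(2,4) by simp
  show "(\<lambda>a. of_bool (q a = 1 \<and> (q' a = 1 \<longrightarrow> b' a < b a)) :: nat) \<in> M \<rightarrow>\<^sub>M count_space UNIV"
    unfolding of_bool_def using assms(2,4) by simp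
qed

section \<open>The value of the Lambert function\<close>

text \<open>The map \<open>x * exp x\<close> has derivative \<open>(1 + x) * exp x\<close>, so it is
  strictly increasing from -1 on and the description in \<open>lambert_W0\<close> is unique; the
  intermediate value theorem on \<open>[-1, 0]\<close> gives existence.\<close>

lemma lambert_W0_neg_exp_minus_2:
  fixes w :: real
  defines "w \<equiv> lambert_W0 (- exp (-2))"
  shows "-1 < w" "w < 0" "w * exp w = - exp (-2)"
proof -
  let ?f = "\<lambda>x::real. x * exp x"
  have mono: "?f x < ?f y" if "-1 \<le> x" "x < y" for x y
  proof (rule DERIV_pos_imp_increasing_open[OF \<open>x < y\<close>])
    fix z assume z: "x < z" "z < y"
    then show "\<exists>D. (?f has_real_derivative D) (at z) \<and> 0 < D"
      using that by (intro exI[of _ "(1 + z) * exp z"] conjI mult_pos_pos)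
        (auto intro!: derivative_eq_intros simp: algebra_simps)
  qed (auto intro!: continuous_intros)
  have "\<exists>x\<ge>-1. x \<le> 0 \<and> ?f x = - exp (-2)"
    by (rule IVT) (auto intro!: continuous_intros)
  then obtain x where x: "-1 \<le> x" "x \<le> 0" "?f x = - exp (-2)" by blast
  have "w = x"
    unfolding w_def lambert_W0_def
    by (rule the_equality) (use x mono in \<open>auto, smt (verit)\<close>)
  moreover have "x \<noteq> 0" "x \<noteq> -1" using x(3) by auto
  ultimately show "-1 < w" "w < 0" "w * exp w = - exp (-2)" using x by auto
qed

section \<open>The instance and the correlated profile\<close>

text \<open>The second condition on \<open>V\<close> reads
  \<open>V * (B + u) \<le> V * (1 - u) - B\<close>: the bound on what \<open>h\<close> can get by an
  affordable deviation is at most its equilibrium utility.\<close>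

locale high_low_auction =
  fixes T :: tie_rule and h l :: nat and u V :: real
  assumes players: "{..<2} = {h, l}" "h \<noteq> l"
    and ties: "((h, 1), (l, 1)) \<in> T 2 1" "((l, 1), (h, 1)) \<notin> T 2 1"
      "((h, 1), (h, 1)) \<notin> T 2 1" "((l, 1), (l, 1)) \<notin> T 2 1"
    and u: "0 < u" "u < 1"
    and V: "1 \<le> V" "V * (1 - u + u * ln u + u) \<le> V * (1 - u) - (1 - u + u * ln u)"
begin

definition "B = 1 - u + u * ln u"
definition "I = single_item_auction h V B"

text \<open>One seed drives both bids, so they always tie. Demanding 0 on the atom lets
  \<open>h\<close> leave the unit to \<open>l\<close>, despite being favoured in ties.\<close>

definition "equilibrium_profile s = (\<lambda>i\<in>{..<2}. (seed_bid u s, if i = h \<and> s \<le> u then 0 else 1::nat))"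

definition "equilibrium = distr unit_uniform (profile_space I (bidders I)) equilibrium_profile"

lemma auction_simps [simp]:
  "num_bidders I = 2" "num_units I = 1" "budget I h = ereal B" "budget I l = \<infinity>"
  "val I h x = (if x = 0 then 0 else V)" "val I l x = (if x = 0 then 0 else 1)"
  using players(2) by (auto simp: I_def single_item_auction_def)

text \<open>Positivity is \<open>ln x < x - 1\<close> at \<open>x = 1 / u\<close>, strict because
  \<open>u\<close> is not 1; the upper bound is \<open>ln u < 0\<close>.\<close>

lemma B_bounds: "0 < B" "B < 1 - u"
proof -
  have "ln (1 / u) \<le> 1 / u - 1" using u by (intro ln_le_minus_one) auto
  moreover have "ln (1 / u) \<noteq> 1 / u - 1" using u ln_eq_minus_one[of "1 / u"] by auto
  ultimately have "- ln u < 1 / u - 1" using u by (simp add: ln_div)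
  then have "u * (- ln u) < u * (1 / u - 1)" using u by (intro mult_strict_left_mono)
  then show "0 < B" using u by (simp add: B_def algebra_simps)
  show "B < 1 - u" using u by (simp add: B_def mult_pos_neg)
qed

text \<open>Makes the budget of \<open>h\<close> the smaller term in its liquid welfare, and its
  equilibrium utility nonnegative.\<close>

lemma B_le: "B \<le> V * (1 - u)"
proof -
  have "1 * (1 - u) \<le> V * (1 - u)" using V u by (intro mult_right_mono) auto
  from order.trans[OF _ this] show ?thesis using B_bounds by simp
qed

lemma player_cases: "i < 2 \<longleftrightarrow> i = h \<or> i = l"
  using players(1) by auto

section \<open>The allocation with one unit\<close>

text \<open>With a single unit, a marginal bid wins exactly when nothing outranks it, and the only
  possible labels are \<open>(h, 1)\<close> and \<open>(l, 1)\<close>.\<close>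

lemma winning_bids_iff:
  assumes "snd (a h) \<le> 1" "snd (a l) \<le> 1"
  shows "(i, x) \<in> winning_bids T I a \<longleftrightarrow> x = 1 \<and> (i = h \<or> i = l) \<and> snd (a i) = 1 \<and>
    (snd (a h) = 1 \<longrightarrow> \<not> outranks T I a (h, 1) (i, 1)) \<and>
    (snd (a l) = 1 \<longrightarrow> \<not> outranks T I a (l, 1) (i, 1))"
proof -
  let ?m = "marginal_bids I a"
  have mem: "(j, y) \<in> ?m \<longleftrightarrow> y = 1 \<and> (j = h \<or> j = l) \<and> snd (a j) = 1" for j y
    using assms by (auto simp: marginal_bids_def player_cases)
  have "finite ?m" by (simp add: marginal_bids_def)
  then have "card {s \<in> ?m. outranks T I a s t} < 1 \<longleftrightarrow> (\<forall>s\<in>?m. \<not> outranks T I a s t)" for t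
    by (subst less_one, subst card_0_eq) auto
  then have "(i, x) \<in> winning_bids T I a \<longleftrightarrow>
      (i, x) \<in> ?m \<and> (\<forall>j y. (j, y) \<in> ?m \<longrightarrow> \<not> outranks T I a (j, y) (i, x))"
    unfolding winning_bids_def auction_simps by auto
  then show ?thesis unfolding mem by blast
qed

lemma units_won_high:
  assumes "snd (a h) \<le> 1" "snd (a l) \<le> 1"
  shows "units_won T I h a =
    of_bool (snd (a h) = 1 \<and> (snd (a l) = 1 \<longrightarrow> fst (a l) \<le> fst (a h)))"
    (is "_ = of_bool ?w")
proof -
  have "outranks T I a (l, 1) (h, 1) \<longleftrightarrow> \<not> fst (a l) \<le> fst (a h)" "\<not> outranks T I a (h, 1) (h, 1)"
    unfolding outranks_def fst_conv auction_simps using ties by (simp_all add: not_le)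
  then have "(h, x) \<in> winning_bids T I a \<longleftrightarrow> x = 1 \<and> ?w" for x
    unfolding winning_bids_iff[OF assms] by blast
  then have "{x. (h, x) \<in> winning_bids T I a} = (if ?w then {1} else {})" by simp
  then show ?thesis unfolding units_won_def by (cases ?w) simp_all
qed

lemma units_won_low:
  assumes "snd (a h) \<le> 1" "snd (a l) \<le> 1"
  shows "units_won T I l a =
    of_bool (snd (a l) = 1 \<and> (snd (a h) = 1 \<longrightarrow> fst (a h) < fst (a l)))"
    (is "_ = of_bool ?w")
proof -
  have "outranks T I a (h, 1) (l, 1) \<longleftrightarrow> \<not> fst (a h) < fst (a l)" "\<not> outranks T I a (l, 1) (l, 1)"
    unfolding outranks_def fst_conv auction_simps using ties by (auto simp: not_less)
  then have "(l, x) \<in> winning_bids T I a \<longleftrightarrow> x = 1 \<and> ?w" for x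
    unfolding winning_bids_iff[OF assms] by blast
  then have "{x. (l, x) \<in> winning_bids T I a} = (if ?w then {1} else {})" by simp
  then show ?thesis unfolding units_won_def by (cases ?w) simp_all
qed

section \<open>Measurability of outcomes\<close>

lemma space_action: "space (action_space I) = {0..} \<times> {0..1}"
  by (simp add: action_space_def space_pair_measure space_restrict_space)

lemma profile_action:
  assumes "a \<in> space (profile_space I (bidders I))" "i = h \<or> i = l"
  shows "0 \<le> fst (a i)" "snd (a i) \<le> 1"
proof -
  have "a i \<in> space (action_space I)"
    using assms player_cases[of i] by (auto simp: profile_space_def space_PiM)
  then show "0 \<le> fst (a i)" "snd (a i) \<le> 1" by (auto simp: space_action)
qed

lemma measurable_profile:
  assumes "i = h \<or> i = l"
  shows "(\<lambda>a. fst (a i)) \<in> borel_measurable (profile_space I (bidders I))"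
    and "(\<lambda>a. snd (a i)) \<in> profile_space I (bidders I) \<rightarrow>\<^sub>M count_space UNIV"
proof -
  have *: "(\<lambda>a. a i) \<in> profile_space I (bidders I) \<rightarrow>\<^sub>M action_space I"
    unfolding profile_space_def using assms player_cases[of i] by (intro measurable_component_singleton) auto
  have "fst \<in> borel_measurable (action_space I)"
    unfolding action_space_def
    by (rule measurable_compose[OF measurable_fst]) (simp add: measurable_restrict_space1)
  from measurable_compose[OF * this] show "(\<lambda>a. fst (a i)) \<in> borel_measurable (profile_space I (bidders I))" .
  have "snd \<in> action_space I \<rightarrow>\<^sub>M count_space UNIV"
    unfolding action_space_def by (rule measurable_compose[OF measurable_snd]) simp
  from measurable_compose[OF * this] show "(\<lambda>a. snd (a i)) \<in> profile_space I (bidders I) \<rightarrow>\<^sub>M count_space UNIV" .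
qed

text \<open>The closed forms hold only for demands of at most 1, which membership in the profile
  space guarantees.\<close>

lemma measurable_units_won:
  assumes "i = h \<or> i = l"
  shows "units_won T I i \<in> profile_space I (bidders I) \<rightarrow>\<^sub>M count_space UNIV"
proof -
  let ?P = "profile_space I (bidders I)"
  note mh = measurable_profile[OF disjI1[OF refl]] and ml = measurable_profile[OF disjI2[OF refl]]
  have "units_won T I h \<in> ?P \<rightarrow>\<^sub>M count_space UNIV"
    using measurable_beats(1)[OF mh ml] by (rule measurable_cong[THEN iffD2, rotated])
      (intro units_won_high profile_action disjI1[OF refl] disjI2[OF refl])
  moreover have "units_won T I l \<in> ?P \<rightarrow>\<^sub>M count_space UNIV"
    using measurable_beats(2)[OF ml mh] by (rule measurable_cong[THEN iffD2, rotated])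
      (intro units_won_low profile_action disjI1[OF refl] disjI2[OF refl])
  ultimately show ?thesis using assms by blast
qed

lemma measurable_outcome:
  assumes "i = h \<or> i = l"
  shows "(\<lambda>a. val I i (units_won T I i a)) \<in> borel_measurable (profile_space I (bidders I))"
    and "payment T I i \<in> borel_measurable (profile_space I (bidders I))"
    and "utility T I i \<in> borel_measurable (profile_space I (bidders I))"
proof -
  note [measurable] = measurable_profile[OF assms] measurable_units_won[OF assms]
  show v[measurable]: "(\<lambda>a. val I i (units_won T I i a)) \<in> borel_measurable (profile_space I (bidders I))"
    by measurable
  show p[measurable]: "payment T I i \<in> borel_measurable (profile_space I (bidders I))"
    unfolding payment_def by measurable
  show "utility T I i \<in> borel_measurable (profile_space I (bidders I))"
    unfolding utility_def by measurable
qed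

section \<open>Equilibrium payments, values and utilities\<close>

lemma measurable_equilibrium_profile:
  "equilibrium_profile \<in> unit_uniform \<rightarrow>\<^sub>M profile_space I (bidders I)"
  unfolding equilibrium_profile_def profile_space_def action_space_def auction_simps
  by (intro measurable_restrict measurable_Pair measurable_restrict_space2)
    (auto simp: seed_bid_nonneg u)

lemma equilibrium_profile_simps:
  "equilibrium_profile s h = (seed_bid u s, if s \<le> u then 0 else 1)"
  "equilibrium_profile s l = (seed_bid u s, 1)"
  using players by (auto simp: equilibrium_profile_def)

lemma equilibrium_units_won:
  "units_won T I h (equilibrium_profile s) = (if s \<le> u then 0 else 1)"
  "units_won T I l (equilibrium_profile s) = (if s \<le> u then 1 else 0)"
  by (simp_all add: units_won_high units_won_low equilibrium_profile_simps)

lemma expect_equilibrium: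
  assumes "f \<in> borel_measurable (profile_space I (bidders I))"
  shows "expect equilibrium f = expect unit_uniform (\<lambda>s. f (equilibrium_profile s))"
  unfolding equilibrium_def using measurable_equilibrium_profile assms by (rule expect_distr)

text \<open>All three integrands vanish on the atom; above it their antiderivatives in the seed are
  \<open>s - u * ln s\<close>, \<open>V * s\<close> and
  \<open>(V - 1) * s + u * ln s\<close>.\<close>

lemma equilibrium_high:
  "expect equilibrium (payment T I h) = ereal B"
  "expect equilibrium (\<lambda>a. val I h (units_won T I h a)) = ereal (V * (1 - u))"
  "expect equilibrium (utility T I h) = ereal (V * (1 - u) - B)"
proof -
  have pay: "payment T I h (equilibrium_profile s) = (if s \<le> u then 0 else 1 - u / s)" for s
    by (simp add: payment_def equilibrium_units_won equilibrium_profile_simps seed_bid_def)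
  have util: "utility T I h (equilibrium_profile s) = (if s \<le> u then 0 else V - 1 + u / s)" for s
    by (simp add: utility_def equilibrium_units_won pay)
  have val: "val I h (units_won T I h (equilibrium_profile s)) = (if s \<le> u then 0 else V)" for s
    by (simp add: equilibrium_units_won)
  have "(\<integral>\<^sup>+s. ennreal (if s \<le> u then 0 else 1 - u / s) \<partial>unit_uniform) =
      ennreal ((1 - u * ln 1) - (u - u * ln u))"
    by (rule nn_integral_unit_uniform_upper) (use u in \<open>auto intro!: derivative_eq_intros\<close>)
  then show "expect equilibrium (payment T I h) = ereal B"
    unfolding expect_equilibrium[OF measurable_outcome(2)[OF disjI1[OF refl]]] pay
    using u B_bounds by (intro expect_nonneg) (auto simp: B_def algebra_simps)
  have "(\<integral>\<^sup>+s. ennreal (if s \<le> u then 0 else V) \<partial>unit_uniform) = ennreal (V * 1 - V * u)"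
    by (rule nn_integral_unit_uniform_upper) (use u V in \<open>auto intro!: derivative_eq_intros\<close>)
  then show "expect equilibrium (\<lambda>a. val I h (units_won T I h a)) = ereal (V * (1 - u))"
    unfolding expect_equilibrium[OF measurable_outcome(1)[OF disjI1[OF refl]]] val
    using u V by (intro expect_nonneg) (auto simp: algebra_simps)
  have "(\<integral>\<^sup>+s. ennreal (if s \<le> u then 0 else V - 1 + u / s) \<partial>unit_uniform) =
      ennreal (((V - 1) * 1 + u * ln 1) - ((V - 1) * u + u * ln u))"
    by (rule nn_integral_unit_uniform_upper) (use u V in \<open>auto intro!: derivative_eq_intros\<close>)
  moreover have "0 \<le> V * (1 - u) - B" using B_le by simp
  moreover have "0 \<le> (if s \<le> u then 0 else V - 1 + u / s)" for s
    using u V divide_pos_pos[of u s] by auto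
  ultimately show "expect equilibrium (utility T I h) = ereal (V * (1 - u) - B)"
    unfolding expect_equilibrium[OF measurable_outcome(3)[OF disjI1[OF refl]]] util
    by (intro expect_nonneg) (auto simp: B_def algebra_simps)
qed

text \<open>The low bidder wins only on the atom, where its bid is 0, so value and utility
  coincide.\<close>

lemma equilibrium_low:
  "expect equilibrium (payment T I l) = 0"
  "expect equilibrium (\<lambda>a. val I l (units_won T I l a)) = ereal u"
  "expect equilibrium (utility T I l) = ereal u"
proof -
  have pay: "payment T I l (equilibrium_profile s) = 0" for s
    by (simp add: payment_def equilibrium_units_won equilibrium_profile_simps seed_bid_def)
  have val: "val I l (units_won T I l (equilibrium_profile s)) = indicator {..u} s" for s
    by (simp add: equilibrium_units_won)
  have util: "utility T I l (equilibrium_profile s) = indicator {..u} s" for s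
    by (simp add: utility_def pay equilibrium_units_won)
  have i: "expect unit_uniform (indicator {..u}) = ereal u"
    using u by (intro expect_nonneg) (auto simp: ennreal_indicator emeasure_unit_uniform_atMost)
  show "expect equilibrium (payment T I l) = 0"
    unfolding expect_equilibrium[OF measurable_outcome(2)[OF disjI2[OF refl]]] pay
    by (simp add: expect_def zero_ennreal.rep_eq)
  show "expect equilibrium (\<lambda>a. val I l (units_won T I l a)) = ereal u"
    unfolding expect_equilibrium[OF measurable_outcome(1)[OF disjI2[OF refl]]] val by (rule i)
  show "expect equilibrium (utility T I l) = ereal u"
    unfolding expect_equilibrium[OF measurable_outcome(3)[OF disjI2[OF refl]]] util by (rule i)
qed

section \<open>Deviations of the two bidders\<close>

text \<open>Winning with bid \<open>b\<close> is worth \<open>1 - b\<close>. Counting ties as wins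
  only enlarges the positive part, which \<open>deviation_win_bound\<close> then caps at
  \<open>u\<close>.\<close>

lemma deviation_low:
  assumes D: "D \<in> distributions (action_space I)"
  shows "deviation_expect l D (others_marginal I l equilibrium) (utility T I l) \<le> ereal u"
proof -
  have lI: "l \<in> bidders I" using player_cases by simp
  have sD: "space D = {0..} \<times> {0..1}"
    using D sets_eq_imp_space_eq[of D "action_space I"] by (simp add: space_prob_algebra space_action)
  have "ennreal (utility T I l ((equilibrium_profile s)(l := x))) \<le>
      ennreal (1 - fst x) * indicator {s. seed_bid u s \<le> fst x} s" if "x \<in> space D" for x s
  proof -
    have x: "0 \<le> fst x" "snd x \<le> 1" using that sD by auto
    have "utility T I l ((equilibrium_profile s)(l := x)) =
        (if snd x = 1 \<and> (u < s \<longrightarrow> seed_bid u s < fst x) then 1 - fst x else 0)"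
      using x players(2) by (auto simp: utility_def payment_def units_won_low equilibrium_profile_simps)
    \<comment> \<open>On the atom \<open>h\<close> demands nothing, so \<open>l\<close> wins at any
      bid; there \<open>seed_bid\<close> is 0 and the inequality still holds.\<close>
    moreover have "seed_bid u s \<le> fst x" if "u < s \<longrightarrow> seed_bid u s < fst x"
      using that x by (auto simp: seed_bid_def)
    ultimately show ?thesis by (auto simp: indicator_def)
  qed
  then have "(\<integral>\<^sup>+(x, s). ennreal (utility T I l ((equilibrium_profile s)(l := x))) \<partial>(D \<Otimes>\<^sub>M unit_uniform)) \<le>
      (\<integral>\<^sup>+(x, s). ennreal (1 - fst x) * indicator {s. seed_bid u s \<le> fst x} s \<partial>(D \<Otimes>\<^sub>M unit_uniform))"
    by (intro nn_integral_mono) (auto simp: space_pair_measure)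
  also have "\<dots> \<le> ennreal u" by (rule deviation_win_bound(1)[OF D u(1)])
  finally show ?thesis
    unfolding equilibrium_def
      deviation_expect_distr(1)[OF lI D measurable_equilibrium_profile prob_space_unit_uniform measurable_outcome(3)[OF disjI2[OF refl]]]
    using u by (intro expect_le) (auto simp: case_prod_unfold)
qed

text \<open>A bid of \<open>b\<close> that wins with probability \<open>p\<close> costs \<open>b p \<ge> p - u\<close> by the choice of
  \<open>seed_bid\<close>, so no budget \<open>B\<close> buys a win probability above \<open>B + u\<close>.\<close>

lemma deviation_high:
  assumes "D \<in> affordable_deviations T I h (others_marginal I h equilibrium)"
  shows "deviation_expect h D (others_marginal I h equilibrium) (utility T I h) \<le> ereal (V * (B + u))"
proof -
  have D: "D \<in> distributions (action_space I)"
    and afford: "deviation_expect h D (others_marginal I h equilibrium) (payment T I h) \<le> ereal B"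
    using assms by (auto simp: affordable_deviations_def)
  have hI: "h \<in> bidders I" using player_cases by simp
  have sD: "space D = {0..} \<times> {0..1}"
    using D sets_eq_imp_space_eq[of D "action_space I"] by (simp add: space_prob_algebra space_action)
  note dev = deviation_expect_distr[OF hI D measurable_equilibrium_profile prob_space_unit_uniform
      measurable_outcome(2)[OF disjI1[OF refl]]]
  let ?p = "\<lambda>(x, s). payment T I h ((equilibrium_profile s)(h := x))"
  let ?e = "\<lambda>(x, s). ennreal (1 - fst x) * indicator {s. seed_bid u s \<le> fst x} s"
  let ?M = "D \<Otimes>\<^sub>M unit_uniform"
  have won: "units_won T I h ((equilibrium_profile s)(h := x)) = of_bool (snd x = 1 \<and> seed_bid u s \<le> fst x)"
    if "x \<in> space D" for x s
    using that sD players(2) by (subst units_won_high) (auto simp: equilibrium_profile_simps)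
  have cost: "(\<integral>\<^sup>+z. ennreal (?p z) \<partial>?M) \<le> ennreal B"
  proof (rule nn_integral_le_of_expect_le)
    show "0 \<le> ?p z" if "z \<in> space ?M" for z
      using that sD by (auto simp: space_pair_measure payment_def)
    show "expect ?M ?p \<le> ereal B"
      using afford unfolding equilibrium_def dev(1) .
  qed (use B_bounds in simp)
  \<comment> \<open>A win is worth at most \<open>V\<close>, and 1 is split into the price paid,
    whose integral the budget bounds, and the rest, whose integral is at most
    \<open>u\<close>.\<close>
  have pw: "ennreal (utility T I h ((equilibrium_profile s)(h := x))) \<le> ennreal V * (ennreal (?p (x, s)) + ?e (x, s))"
    if "x \<in> space D" for x s
  proof -
    have x: "0 \<le> fst x" using that sD by auto
    show ?thesis
    proof (cases "snd x = 1 \<and> seed_bid u s \<le> fst x")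
      case True
      have "ennreal (utility T I h ((equilibrium_profile s)(h := x))) \<le> ennreal V * 1"
        using True x by (simp add: utility_def payment_def won[OF that] ennreal_leI)
      \<comment> \<open>Truncation at 0 makes this hold for bids above 1 as well.\<close>
      also have "1 \<le> ennreal (fst x) + ennreal (1 - fst x)"
        using x by (cases "fst x \<le> 1") (auto simp: ennreal_neg simp flip: ennreal_plus ennreal_1)
      then have "ennreal V * 1 \<le> ennreal V * (ennreal (fst x) + ennreal (1 - fst x))"
        by (rule mult_left_mono) simp
      finally show ?thesis using True by (simp add: payment_def won[OF that])
    next
      case False
      then have "units_won T I h ((equilibrium_profile s)(h := x)) = 0"
        unfolding won[OF that] by (simp only: of_bool_eq)
      then show ?thesis by (simp add: utility_def payment_def)
    qed
  qed
  have mp: "?p \<in> borel_measurable ?M" by (rule dev(2))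
  have me: "?e \<in> borel_measurable ?M" by (rule deviation_win_bound(2)[OF D u(1)])
  have "(\<integral>\<^sup>+z. ennreal ((\<lambda>(x, s). utility T I h ((equilibrium_profile s)(h := x))) z) \<partial>?M) \<le>
      (\<integral>\<^sup>+z. ennreal V * (ennreal (?p z) + ?e z) \<partial>?M)"
    using pw by (intro nn_integral_mono) (auto simp: space_pair_measure)
  also have "\<dots> = ennreal V * (\<integral>\<^sup>+z. (ennreal (?p z) + ?e z) \<partial>?M)"
    by (intro nn_integral_cmult borel_measurable_add measurable_compose[OF mp measurable_ennreal] me)
  also have "\<dots> = ennreal V * ((\<integral>\<^sup>+z. ennreal (?p z) \<partial>?M) + (\<integral>\<^sup>+z. ?e z \<partial>?M))"
    by (subst nn_integral_add[OF measurable_compose[OF mp measurable_ennreal] me]) simp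
  also have "\<dots> \<le> ennreal V * (ennreal B + ennreal u)"
    by (intro mult_left_mono add_mono cost deviation_win_bound(1)[OF D u(1)]) simp
  also have "\<dots> = ennreal (V * (B + u))"
    using V u B_bounds by (simp add: ennreal_mult)
  finally show ?thesis
    unfolding equilibrium_def
      deviation_expect_distr(1)[OF hI D measurable_equilibrium_profile prob_space_unit_uniform measurable_outcome(3)[OF disjI1[OF refl]]]
    using u V B_bounds by (intro expect_le) auto
qed

section \<open>Equilibrium property and welfare comparison\<close>

lemma valid: "valid_instance I"
  using B_bounds V unfolding valid_instance_def concave_valuation_def
  by (auto simp: player_cases)

lemma equilibrium: "coarse_correlated_equilibrium T I equilibrium"
proof -
  have "equilibrium \<in> distributions (profile_space I (bidders I))"
    unfolding equilibrium_def space_prob_algebra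
    using prob_space.prob_space_distr[OF prob_space_unit_uniform measurable_equilibrium_profile] by simp
  moreover have "deviation_expect l D (others_marginal I l equilibrium) (utility T I l) \<le> expect equilibrium (utility T I l)"
    if "D \<in> affordable_deviations T I l (others_marginal I l equilibrium)" for D
    using deviation_low that unfolding equilibrium_low affordable_deviations_def by blast
  moreover have "deviation_expect h D (others_marginal I h equilibrium) (utility T I h) \<le> expect equilibrium (utility T I h)"
    if "D \<in> affordable_deviations T I h (others_marginal I h equilibrium)" for D
    using order.trans[OF deviation_high[OF that]] V(2) unfolding equilibrium_high by (simp add: B_def)
  ultimately show ?thesis
    unfolding coarse_correlated_equilibrium_def
    by (auto simp: player_cases equilibrium_high equilibrium_low)
qed

lemma sum_players: "(\<Sum>i\<in>bidders I. f i) = f h + f l" for f :: "nat \<Rightarrow> 'a::comm_monoid_add"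
  using players by simp

lemma liquid_welfare: "liquid_welfare T I equilibrium = ereal (B + u)"
  unfolding liquid_welfare_def sum_players equilibrium_high(2) equilibrium_low(2) using B_le by simp

text \<open>Witness: \<open>h\<close> gets the unit with probability \<open>B / V\<close>, for an
  expected value of exactly its budget, and \<open>l\<close> gets it otherwise.\<close>

lemma optimal_liquid_welfare: "ereal (B + 1 - B / V) \<le> optimal_liquid_welfare I"
proof -
  let ?F = "feasible_allocations I"
  let ?x = "\<lambda>b. \<lambda>i\<in>{..<2}. of_bool ((i = h) = b) :: nat"
  let ?m = "measure_pmf (bernoulli_pmf (B / V))"
  let ?D = "distr ?m (count_space ?F) ?x"
  have p: "0 \<le> B / V" "B / V \<le> 1" using B_bounds V u by auto
  have xF: "?x b \<in> ?F" for b
    using players by (auto simp: feasible_allocations_def)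
  have mx: "?x \<in> ?m \<rightarrow>\<^sub>M count_space ?F" using xF by simp
  have D: "?D \<in> distributions (count_space ?F)"
    using measure_pmf.prob_space_distr[OF mx] by (simp add: space_prob_algebra)
  have e: "expect ?D f = ereal (integral\<^sup>L ?m (\<lambda>b. f (?x b)))" if "\<And>x. 0 \<le> f x" for f
  proof -
    have i: "integrable ?m (\<lambda>b. f (?x b))" by (rule integrable_measure_pmf_finite) simp
    show ?thesis
      by (subst expect_distr[OF mx]) (use that in \<open>auto intro!: expect_nonneg nn_integral_eq_integral i integral_nonneg\<close>)
  qed
  have "expect ?D (\<lambda>x. val I h (x h)) = ereal B"
    by (subst e) (use p players V in \<open>auto\<close>)
  moreover have "expect ?D (\<lambda>x. val I l (x l)) = ereal (1 - B / V)"
    by (subst e) (use p players V in \<open>auto\<close>)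
  ultimately have "(\<Sum>i\<in>bidders I. min (expect ?D (\<lambda>x. val I i (x i))) (budget I i)) = ereal (B + 1 - B / V)"
    by (simp only: sum_players) simp
  then show ?thesis
    unfolding optimal_liquid_welfare_def by (intro SUP_upper2[OF D]) (simp only: order_refl)
qed

lemma price_of_anarchy: "ereal ((B + 1 - B / V) / (B + u)) \<le> price_of_anarchy T"
proof -
  have "ereal ((B + 1 - B / V) / (B + u)) \<le> optimal_liquid_welfare I / liquid_welfare T I equilibrium"
    using ereal_divide_right_mono[OF optimal_liquid_welfare, of "ereal (B + u)"] B_bounds u
    by (simp add: liquid_welfare)
  also have "\<dots> \<le> price_of_anarchy T"
    unfolding price_of_anarchy_def using valid equilibrium by (intro Sup_upper) blast
  finally show ?thesis .
qed

end

section \<open>Choice of roles and the limit of large \<open>V\<close>\<close>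

text \<open>Totality favours one of the two bidders; transitivity and irreflexivity exclude the
  reverse preference. The favoured one becomes \<open>h\<close>.\<close>

lemma tie_rule_roles:
  assumes "consistent_ties T"
  obtains h l :: nat where "{..<2} = {h, l}" "h \<noteq> l"
    "((h, 1), (l, 1)) \<in> T 2 1" "((l, 1), (h, 1)) \<notin> T 2 1"
    "((h, 1), (h, 1)) \<notin> T 2 1" "((l, 1), (l, 1)) \<notin> T 2 1"
proof -
  have "strict_linear_order_on ({..<2} \<times> {1..1}) (T 2 1)"
    using assms unfolding consistent_ties_def by blast
  then have tr: "trans (T 2 1)" and ir: "irrefl (T 2 1)" and "total_on ({..<2} \<times> {1..1}) (T 2 1)"
    by (auto simp: strict_linear_order_on_def)
  then have "((0, 1), (1, 1)) \<in> T 2 1 \<or> ((1, 1), (0, 1)) \<in> T 2 1"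
    unfolding total_on_def by auto
  moreover have "\<not> (((0, 1), (1, 1)) \<in> T 2 1 \<and> ((1, 1), (0, 1)) \<in> T 2 1)"
    using tr ir by (meson irrefl_def transD)
  moreover have "{..<2} = {0, 1::nat}" "{..<2} = {1, 0::nat}" by auto
  moreover have "(x, x) \<notin> T 2 1" for x using ir unfolding irrefl_def by blast
  ultimately show thesis
    using that[of 0 1] that[of 1 0] by (metis zero_neq_one)
qed

theorem theorem5p2:
  fixes T :: tie_rule
  assumes "consistent_ties T"
  shows "ereal ((2 + lambert_W0 (- exp (-2))) / (1 + lambert_W0 (- exp (-2)))) \<le> price_of_anarchy T"
proof -
  obtain h l :: nat where roles: "{..<2} = {h, l}" "h \<noteq> l"
    "((h, 1), (l, 1)) \<in> T 2 1" "((l, 1), (h, 1)) \<notin> T 2 1"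
    "((h, 1), (h, 1)) \<notin> T 2 1" "((l, 1), (l, 1)) \<notin> T 2 1"
    using tie_rule_roles[OF assms] by blast
  define u where "u = - lambert_W0 (- exp (-2))"
  have u: "0 < u" "u < 1" and "u * exp (- u) = exp (-2)"
    using lambert_W0_neg_exp_minus_2 by (auto simp: u_def)
  then have "ln (u * exp (- u)) = -2" by simp
  then have ln_u: "ln u = u - 2" using u by (simp add: ln_mult)
  define B where "B = 1 - u + u * ln u"
  \<comment> \<open>This is where the choice of \<open>u\<close> enters, through
    \<open>ln u = u - 2\<close>.\<close>
  have B: "B + u = (1 - u)\<^sup>2" by (simp add: B_def ln_u power2_eq_square algebra_simps)
  \<comment> \<open>With \<open>B + u = (1 - u)\<^sup>2\<close>, the second locale condition on
    \<open>V\<close> amounts to \<open>B \<le> V * (u * (1 - u))\<close>, hence the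
    threshold.\<close>
  have ev: "eventually (\<lambda>V. ereal ((B + 1 - B / V) / (B + u)) \<le> price_of_anarchy T) at_top"
    using eventually_ge_at_top[of 1] eventually_ge_at_top[of "B / (u * (1 - u))"]
  proof eventually_elim
    case (elim V)
    then have "B \<le> V * (u * (1 - u))" using u by (simp add: field_simps)
    moreover have "V * (1 - u)\<^sup>2 = V * (1 - u) - V * (u * (1 - u))"
      by (simp add: power2_eq_square algebra_simps)
    ultimately have "V * (B + u) \<le> V * (1 - u) - B" unfolding B by simp
    then have "V * (1 - u + u * ln u + u) \<le> V * (1 - u) - (1 - u + u * ln u)"
      unfolding B_def .
    then interpret A: high_low_auction T h l u V
      using roles u elim by unfold_locales auto
    show ?case using A.price_of_anarchy by (simp add: A.B_def B_def)
  qed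
  have "((\<lambda>V. (B + 1 - B / V) / (B + u)) \<longlongrightarrow> (B + 1 - 0) / (B + u)) at_top"
    using u by (intro tendsto_intros tendsto_divide_0[OF tendsto_const] filterlim_at_top_imp_at_infinity filterlim_ident) (simp add: B)
  then have "((\<lambda>V. ereal ((B + 1 - B / V) / (B + u))) \<longlongrightarrow> ereal ((B + 1 - 0) / (B + u))) at_top"
    by simp
  \<comment> \<open>No single instance has to reach the limit ratio: the price of anarchy bounds the
    ratios for all large \<open>V\<close>, hence also their limit.\<close>
  then have "ereal ((B + 1 - 0) / (B + u)) \<le> price_of_anarchy T"
    using ev by (rule tendsto_upperbound) simp
  moreover have "(B + 1 - 0) / (B + u) = (2 - u) / (1 - u)"
  proof -
    have "B + 1 = (1 - u) * (2 - u)" using B by (simp add: power2_eq_square algebra_simps)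
    then show ?thesis using u B by (simp add: power2_eq_square)
  qed
  ultimately show ?thesis by (simp add: u_def)
qed

end
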